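(* Let $p$ be a prime number. For any integers $a, b, m, n \in \{1, 2, \ldots, p-1\}$ with $a \neq b$, we have the following congruence modulo $p$: $$\sum_{k=0}^{p-1} (a+k)^m (b+k)^n \equiv \begin{cases} -2, & \text{if } m=n=p-1,\\ -(a-b)^{m+n}\binom{m}{p-1-n}, & \text{otherwise}. \end{cases}$$
   Context: Binomial coefficients $\binom{u}{v}$ are $0$ unless $0 \le v \le u$. *)

theory Defs
  imports "HOL-Number_Theory.Number_Theory"
begin

end

theory Submission imports Defs begin

text \<open>
  The summand depends on \<open>k\<close> only modulo \<open>p\<close>, so the sum runs over the field with \<open>p\<close> elements and
  may be translated: with \<open>d = a - b\<close> it is congruent to the sum of \<open>(x + d)^m * x^n\<close> over all
  residues \<open>x\<close>. Expanding \<open>(x + d)^m\<close> binomially reduces the problem to the power sums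
  \<open>\<Sum>x. x^e\<close> with \<open>e = n + j\<close> and \<open>0 \<le> j \<le> m\<close>. For \<open>e > 0\<close> such a power sum is \<open>-1\<close> if \<open>p - 1\<close>
  divides \<open>e\<close>, and \<open>0\<close> otherwise (\<open>power_sum_cong_prime\<close>).

  Now \<open>0 < e \<le> 2 * (p - 1)\<close>, so only \<open>e = p - 1\<close> and \<open>e = 2 * (p - 1)\<close> survive. The second exponent
  occurs only for \<open>m = n = p - 1\<close>; then \<open>j = 0\<close> and \<open>j = m\<close> contribute \<open>-1\<close> each, giving \<open>-2\<close>.
  In all other cases only \<open>j = p - 1 - n\<close> can survive. If it exceeds \<open>m\<close>, no term is left and the
  binomial coefficient on the right vanishes as well. Otherwise its contribution is
  \<open>-(m choose j) * d^(m - j)\<close>, where the factor \<open>d^(m - j)\<close> may be replaced by \<open>d^(m + n)\<close>, because the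
  exponents differ by \<open>p - 1\<close> and \<open>d\<close> is a unit modulo \<open>p\<close>.
\<close>

lemma sum_over_complete_residue_system_cong:
  fixes f h :: "int \<Rightarrow> int" and p :: int
  assumes "p > 0"
    and inj: "\<And>x y. x \<in> {0..<p} \<Longrightarrow> y \<in> {0..<p} \<Longrightarrow> [h x = h y] (mod p) \<Longrightarrow> x = y"
    and periodic: "\<And>x. [f (x mod p) = f x] (mod p)"
  shows "[(\<Sum>x\<in>{0..<p}. f (h x)) = (\<Sum>x\<in>{0..<p}. f x)] (mod p)"
proof -
  have inj': "inj_on (\<lambda>x. h x mod p) {0..<p}"
    by (rule inj_onI) (rule inj, simp_all only: cong_def)
  moreover have "(\<lambda>x. h x mod p) ` {0..<p} \<subseteq> {0..<p}"
    using \<open>p > 0\<close> by (intro image_subsetI) simp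
  ultimately have "bij_betw (\<lambda>x. h x mod p) {0..<p} {0..<p}"
    using endo_inj_surj[of "{0..<p}"] unfolding bij_betw_def by blast
  then have "(\<Sum>x\<in>{0..<p}. f (h x mod p)) = (\<Sum>x\<in>{0..<p}. f x)"
    by (rule sum.reindex_bij_betw)
  moreover have "[(\<Sum>x\<in>{0..<p}. f (h x mod p)) = (\<Sum>x\<in>{0..<p}. f (h x))] (mod p)"
    by (intro cong_sum periodic)
  ultimately show ?thesis
    by (simp only: cong_sym_eq)
qed

lemma fermat_theorem_int:
  fixes x :: int
  assumes "prime p" and "\<not> int p dvd x"
  shows "[x ^ (p - 1) = 1] (mod int p)"
proof -
  let ?y = "nat (x mod int p)"
  have y: "int ?y = x mod int p"
    using prime_gt_0_nat[OF \<open>prime p\<close>] by simp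
  have "\<not> int p dvd int ?y"
    using \<open>\<not> int p dvd x\<close> unfolding y by (simp add: dvd_mod_iff)
  then have "\<not> p dvd ?y" by (simp only: int_dvd_int_iff not_False_eq_True)
  then have "[?y ^ (p - 1) = 1] (mod p)"
    by (rule fermat_theorem[OF \<open>prime p\<close>])
  then have "[(x mod int p) ^ (p - 1) = 1] (mod int p)"
    using cong_int_iff[of "?y ^ (p - 1)" 1 p] by (simp only: of_nat_power of_nat_1 y)
  then show ?thesis
    by (simp add: cong_def power_mod)
qed

text \<open>
  If \<open>p - 1\<close> divides \<open>e\<close>, Fermat turns every nonzero term into \<open>1\<close>. Otherwise take a primitive root
  \<open>g\<close>: multiplying the residues by \<open>g\<close> permutes them, so the sum \<open>S\<close> satisfies \<open>g^e * S \<equiv> S\<close>, and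
  \<open>g^e - 1\<close> is invertible because the order \<open>p - 1\<close> of \<open>g\<close> does not divide \<open>e\<close>.
\<close>
lemma power_sum_cong_prime:
  fixes p e :: nat
  assumes "prime p" and "e > 0"
  shows "[(\<Sum>x\<in>{0..<int p}. x ^ e) = (if p - 1 dvd e then - 1 else 0)] (mod int p)"
proof (cases "p - 1 dvd e")
  case True
  then obtain c where c: "e = (p - 1) * c" by blast
  have "[x ^ e = 1] (mod int p)" if "x \<in> {1..<int p}" for x
  proof -
    have "\<not> int p dvd x" using that zdvd_imp_le[of "int p" x] by auto
    then have "[(x ^ (p - 1)) ^ c = 1 ^ c] (mod int p)"
      using fermat_theorem_int \<open>prime p\<close> by (intro cong_pow)
    then show ?thesis by (simp add: c power_mult)
  qed
  then have "[(\<Sum>x\<in>{1..<int p}. x ^ e) = (\<Sum>x\<in>{1..<int p}. 1)] (mod int p)"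
    by (intro cong_sum)
  moreover have "{0..<int p} = insert 0 {1..<int p}"
    using prime_gt_0_nat[OF \<open>prime p\<close>] by auto
  moreover have "[int p - 1 = - 1] (mod int p)"
    by (simp add: cong_iff_dvd_diff)
  ultimately show ?thesis
    using True \<open>e > 0\<close> prime_gt_0_nat[OF \<open>prime p\<close>]
    by (auto simp: power_0_left intro: cong_trans)
next
  case False
  obtain g where g: "residue_primroot p g"
    using prime_primitive_root_exists[of p] \<open>prime p\<close> prime_gt_1_nat[of p] by auto
  then have "coprime p g" and ord: "ord p g = p - 1"
    using \<open>prime p\<close> by (auto simp: residue_primroot_def totient_prime)
  then have cop: "coprime (int g) (int p)"
    by (simp add: coprime_commute)
  define S where "S = (\<Sum>x\<in>{0..<int p}. x ^ e)"
  have "[(\<Sum>x\<in>{0..<int p}. (int g * x) ^ e) = S] (mod int p)"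
    unfolding S_def
  proof (rule sum_over_complete_residue_system_cong)
    fix x y assume "x \<in> {0..<int p}" "y \<in> {0..<int p}" "[int g * x = int g * y] (mod int p)"
    then show "x = y"
      using cop by (auto simp: cong_mult_lcancel cong_less_imp_eq_int)
  qed (use \<open>prime p\<close> in \<open>auto simp: prime_gt_0_nat cong_def power_mod\<close>)
  then have "int p dvd (int g ^ e - 1) * S"
    by (simp add: S_def power_mult_distrib sum_distrib_left[symmetric] cong_iff_dvd_diff
        left_diff_distrib)
  moreover have "\<not> int p dvd int g ^ e - 1"
  proof
    assume "int p dvd int g ^ e - 1"
    then have "[int (g ^ e) = int 1] (mod int p)" by (simp add: cong_iff_dvd_diff)
    then have "[g ^ e = 1] (mod p)" unfolding cong_int_iff .
    then have "ord p g dvd e" by (rule iffD1[OF ord_divides])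
    then show False using ord False by metis
  qed
  ultimately have "int p dvd S"
    using \<open>prime p\<close> by (simp add: prime_dvd_mult_iff)
  then show ?thesis
    using False by (simp add: S_def cong_0_iff)
qed

text \<open>Evaluating the power sums leaves only the binomial terms whose exponent \<open>n + j\<close> is a multiple
  of \<open>p - 1\<close>.\<close>
lemma sum_power_mult_shifted_power_cong_prime:
  fixes p m n :: nat and d :: int
  assumes "prime p" and "n > 0"
  shows "[(\<Sum>x\<in>{0..<int p}. (x + d) ^ m * x ^ n) =
          - (\<Sum>j\<in>{j. j \<le> m \<and> p - 1 dvd n + j}. int (m choose j) * d ^ (m - j))] (mod int p)"
proof -
  have "(\<Sum>x\<in>{0..<int p}. (x + d) ^ m * x ^ n)
      = (\<Sum>x\<in>{0..<int p}. \<Sum>j\<le>m. int (m choose j) * d ^ (m - j) * x ^ (n + j))"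
    unfolding binomial_ring sum_distrib_right
    by (intro sum.cong refl) (simp add: power_add)
  also have "\<dots> = (\<Sum>j\<le>m. int (m choose j) * d ^ (m - j) * (\<Sum>x\<in>{0..<int p}. x ^ (n + j)))"
    by (subst sum.swap) (simp add: sum_distrib_left)
  also have "[\<dots> = (\<Sum>j\<le>m. int (m choose j) * d ^ (m - j) * (if p - 1 dvd n + j then - 1 else 0))]
      (mod int p)"
    using assms by (intro cong_sum cong_mult cong_refl power_sum_cong_prime) auto
  also have "(\<Sum>j\<le>m. int (m choose j) * d ^ (m - j) * (if p - 1 dvd n + j then - 1 else 0))
      = (\<Sum>j\<le>m. if p - 1 dvd n + j then - (int (m choose j) * d ^ (m - j)) else 0)"
    by (intro sum.cong) auto
  also have "\<dots> = (\<Sum>j\<in>{j. j \<le> m \<and> p - 1 dvd n + j}. - (int (m choose j) * d ^ (m - j)))"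
    by (subst sum.inter_filter[symmetric]) auto
  finally show ?thesis
    by (simp add: sum_negf)
qed

theorem theorem2p8:
  fixes p m n :: nat and a b :: int
  assumes "prime p"
    and "a \<in> {1..int p - 1}" and "b \<in> {1..int p - 1}"
    and "m \<in> {1..p - 1}" and "n \<in> {1..p - 1}"
    and "a \<noteq> b"
  shows "[(\<Sum>k = 0..p - 1. (a + int k) ^ m * (b + int k) ^ n) =
          (if m = p - 1 \<and> n = p - 1 then - 2
           else - ((a - b) ^ (m + n) * int (m choose (p - 1 - n))))] (mod int p)"
proof -
  define d where "d = a - b"
  define J where "J = {j. j \<le> m \<and> p - 1 dvd n + j}"
  have n_le: "n \<le> p - 1" using assms by simp
  have "p > 1" using \<open>prime p\<close> by (rule prime_gt_1_nat)
  have "\<not> int p dvd d"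
    using assms zdvd_imp_le[of "int p" "\<bar>d\<bar>"] by (auto simp: d_def)
  then have fermat: "[d ^ (p - 1) = 1] (mod int p)"
    using \<open>prime p\<close> by (rule fermat_theorem_int[rotated])
  have "(\<Sum>k = 0..p - 1. (a + int k) ^ m * (b + int k) ^ n)
      = (\<Sum>x\<in>{0..<int p}. ((b + x) + d) ^ m * (b + x) ^ n)"
    by (rule sum.reindex_bij_witness[of _ nat int])
      (use \<open>p > 1\<close> in \<open>auto simp: d_def algebra_simps\<close>)
  also have "[\<dots> = (\<Sum>x\<in>{0..<int p}. (x + d) ^ m * x ^ n)] (mod int p)"
  proof (rule sum_over_complete_residue_system_cong)
    fix x y assume "x \<in> {0..<int p}" "y \<in> {0..<int p}" "[b + x = b + y] (mod int p)"
    then show "x = y"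
      by (auto simp: cong_add_lcancel cong_less_imp_eq_int)
  next
    fix x
    show "[(x mod int p + d) ^ m * (x mod int p) ^ n = (x + d) ^ m * x ^ n] (mod int p)"
      by (intro cong_mult cong_pow cong_add) (auto simp: cong_def)
  qed (use \<open>p > 1\<close> in auto)
  also have "[(\<Sum>x\<in>{0..<int p}. (x + d) ^ m * x ^ n) =
      - (\<Sum>j\<in>J. int (m choose j) * d ^ (m - j))] (mod int p)"
    unfolding J_def using assms by (intro sum_power_mult_shifted_power_cong_prime) auto
  also have "[- (\<Sum>j\<in>J. int (m choose j) * d ^ (m - j)) =
      (if m = p - 1 \<and> n = p - 1 then - 2
       else - (d ^ (m + n) * int (m choose (p - 1 - n))))] (mod int p)"
  proof (cases "m = p - 1 \<and> n = p - 1")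
    case True
    have "J = {0, p - 1}"
    proof -
      have "j = 0 \<or> j = p - 1" if "j \<le> p - 1" "p - 1 dvd j" for j
        using that dvd_imp_le[of "p - 1" j] by auto
      then show ?thesis using True by (auto simp: J_def)
    qed
    then have "- (\<Sum>j\<in>J. int (m choose j) * d ^ (m - j)) = - (d ^ (p - 1) + 1)"
      using True \<open>p > 1\<close> by simp
    moreover have "[- (d ^ (p - 1) + 1) = - (1 + 1)] (mod int p)"
      using fermat by (simp only: cong_minus_minus_iff cong_add_rcancel)
    ultimately show ?thesis using True by simp
  next
    case not_both_maximal: False
    \<comment> \<open>Since \<open>0 < n + j < 2 * (p - 1)\<close>, divisibility by \<open>p - 1\<close> forces equality.\<close>
    have unique: "j = p - 1 - n" if "j \<in> J" for j
    proof -
      have "j \<le> m" and "p - 1 dvd n + j"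
        using that by (simp_all add: J_def)
      then obtain c where c: "n + j = (p - 1) * c" by blast
      have "m \<le> p - 1" and pos: "n + j > 0" using assms by simp_all
      then have lt: "n + j < (p - 1) * 2"
        using not_both_maximal n_le \<open>j \<le> m\<close> by linarith
      have "c < 2" using lt c by (metis mult_less_cancel1)
      moreover have "c \<noteq> 0" using pos c by (intro notI) simp
      ultimately have "c = 1" by simp
      then show ?thesis using c by simp
    qed
    show ?thesis
    proof (cases "p - 1 - n \<le> m")
      case True
      moreover have "n + (p - 1 - n) = p - 1" using n_le by simp
      ultimately have "p - 1 - n \<in> J" by (simp only: J_def mem_Collect_eq dvd_refl simp_thms)
      with unique have "J = {p - 1 - n}" by blast
      moreover have "[d ^ (m + n) = d ^ (m - (p - 1 - n))] (mod int p)"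
      proof -
        have "m + n = (p - 1) + (m - (p - 1 - n))" using True n_le by linarith
        then have "d ^ (m + n) = d ^ (p - 1) * d ^ (m - (p - 1 - n))"
          by (metis power_add)
        then show ?thesis using cong_scalar_right[OF fermat, of "d ^ (m - (p - 1 - n))"] by simp
      qed
      then have "[d ^ (m - (p - 1 - n)) * int (m choose (p - 1 - n))
          = d ^ (m + n) * int (m choose (p - 1 - n))] (mod int p)"
        by (intro cong_scalar_right) (rule cong_sym)
      ultimately have "[(\<Sum>j\<in>J. int (m choose j) * d ^ (m - j))
          = d ^ (m + n) * int (m choose (p - 1 - n))] (mod int p)"
        by (simp add: mult.commute)
      then show ?thesis
        by (simp only: not_both_maximal if_False cong_minus_minus_iff)
    next
      case False
      then have "j \<notin> J" for j using unique[of j] by (auto simp: J_def)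
      then have "J = {}" by blast
      moreover have "m choose (p - 1 - n) = 0" using False by (intro binomial_eq_0) simp
      ultimately show ?thesis by (simp only: not_both_maximal if_False) simp
    qed
  qed
  finally show ?thesis by (simp only: d_def)
qed

end
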